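(* Let $k = 2\ell$ be an even integer, and let $m \ge -\ell$ and $n \ge \ell+1$ be integers. Let $a_k^{(4)}(m,n)$ denote the coefficient of $q^n$ in $f_{k,m}^{(4)}(z)$ and let $b_{2-k}^{(4)}(n,m)$ denote the coefficient of $q^m$ in $g_{2-k,n}^{(4)}(z)$. Then $$a_k^{(4)}(m,n) = -b_{2-k}^{(4)}(n,m).$$
   Context: $\Gamma_0(4) = \left\{ \begin{pmatrix} a & b \\ c & d\end{pmatrix} \in \mathrm{SL}_2(\mathbb{Z}) : c \equiv 0 \pmod 4 \right\}$, and $q = e^{2\pi i z}$ for $z$ in the upper half plane. $M_k^\sharp(4)$ is the space of weakly holomorphic modular forms of even integer weight $k$ for $\Gamma_0(4)$ (holomorphic on the upper half plane, meromorphic at the cusps) that are holomorphic away from the cusp at $\infty$, i.e. also holomorphic at the cusps $0$ and $\frac12$. For an even weight $k = 2\ell$ and an integer $m \ge -\ell$, $f_{k,m}^{(4)}$ is the unique element of $M_k^\sharp(4)$ with Fourier expansion $$f_{k,m}^{(4)}(z) = q^{-m} + \sum_{n=\ell+1}^\infty a_k^{(4)}(m,n) q^n.$$ For an even weight $k = 2\ell$ and an integer $m \ge -\ell+2$, $g_{k,m}^{(4)}$ is the unique element of $M_k^\sharp(4)$ that vanishes at the cusps $0$ and $\frac12$ and has Fourier expansion $$g_{k,m}^{(4)}(z) = q^{-m} + \sum_{n=\ell-1}^\infty b_k^{(4)}(m,n) q^n.$$ (In particular, for $k=2\ell$, the form $g_{2-k,n}^{(4)}$ of weight $2-k = 2(1-\ell)$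 is defined for $n \ge \ell+1$, and its coefficients $b_{2-k}^{(4)}(n,m)$ are defined for $m \ge -\ell$.) *)

theory Defs
  imports "HOL-Complex_Analysis.Complex_Analysis" "HOL-Number_Theory.Cong"
begin

definition upper_half_plane :: "complex set" where
  "upper_half_plane = {z. Im z > 0}"

definition SL2Z :: "(int ^ 2 ^ 2) set" where
  "SL2Z = {A. det A = 1}"

definition Gamma0 :: "int \<Rightarrow> (int ^ 2 ^ 2) set" where
  "Gamma0 N = {A \<in> SL2Z. [A $ 2 $ 1 = 0] (mod N)}"

definition moebius_mat :: "int ^ 2 ^ 2 \<Rightarrow> complex \<Rightarrow> complex" where
  "moebius_mat A z =
     (of_int (A $ 1 $ 1) * z + of_int (A $ 1 $ 2)) / (of_int (A $ 2 $ 1) * z + of_int (A $ 2 $ 2))"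

definition slash :: "int \<Rightarrow> (complex \<Rightarrow> complex) \<Rightarrow> int ^ 2 ^ 2 \<Rightarrow> complex \<Rightarrow> complex" where
  "slash k f A z =
     (of_int (A $ 2 $ 1) * z + of_int (A $ 2 $ 2)) powi (- k) * f (moebius_mat A z)"

text \<open>
  An expansion \<open>f z = (\<Sum>n \<ge> n0. F n * exp (2 * pi * i * n * z / h))\<close>, valid on the whole upper
  half plane. Formal Laurent series have finite principal part, so only expansions that are
  meromorphic at infinity are covered; the radius condition is needed because \<open>eval_fls\<close> is total.
\<close>
definition has_q_expansion :: "nat \<Rightarrow> (complex \<Rightarrow> complex) \<Rightarrow> complex fls \<Rightarrow> bool" where
  "has_q_expansion h f F \<longleftrightarrow>
     fls_conv_radius F \<ge> 1 \<and>
     (\<forall>z\<in>upper_half_plane. f z = eval_fls F (exp (2 * of_real pi * \<i> * z / of_nat h)))"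

lemma has_q_expansion_unique:
  assumes "has_q_expansion h f F" "has_q_expansion h f G" "h > 0"
  shows   "F = G"
proof -
  have eq: "eval_fls F x = eval_fls G x" if x: "x \<noteq> 0" "norm x < 1" for x
  proof -
    define z where "z = of_nat h * Ln x / (2 * of_real pi * \<i>)"
    have z': "z = of_real (real h / (2 * pi)) * (- \<i> * Ln x)"
      by (simp add: z_def field_simps)
    have "Im z = (real h / (2 * pi)) * (- ln (norm x))"
      unfolding z' using x by (simp del: of_real_divide of_real_mult add: Re_Ln)
    also have "\<dots> > 0"
      using x assms(3) by (intro mult_pos_pos) (auto simp: ln_less_zero_iff)
    finally have "z \<in> upper_half_plane"
      by (simp add: upper_half_plane_def)
    moreover have "exp (2 * of_real pi * \<i> * z / of_nat h) = x"
      using x assms(3) by (simp add: z_def)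
    ultimately show ?thesis
      using assms(1,2) by (metis has_q_expansion_def)
  qed
  have ev: "eventually (\<lambda>x. x \<noteq> 0 \<and> norm x < 1) (at (0::complex))"
    by (auto simp: eventually_at intro!: exI[of _ 1])
  have rad: "0 < fls_conv_radius F" "0 < fls_conv_radius G"
    using assms(1,2) less_le_trans[of 0 "1::ereal"] by (auto simp: has_q_expansion_def)
  have "eval_fls F has_laurent_expansion F"
    using rad by (auto simp: has_laurent_expansion_def)
  moreover have "eval_fls F has_laurent_expansion G"
    using rad eventually_mono[OF ev] eq by (auto simp: has_laurent_expansion_def)
  ultimately show ?thesis
    using has_laurent_expansion_unique by blast
qed

text \<open>The coefficient of \<open>q ^ n\<close>, \<open>q = exp (2 * pi * i * z)\<close>; meaningful if such an expansion exists.\<close>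
definition q_coeff :: "(complex \<Rightarrow> complex) \<Rightarrow> int \<Rightarrow> complex" where
  "q_coeff f n = fls_nth (THE F. has_q_expansion 1 f F) n"

lemma q_coeff_eq: "has_q_expansion 1 f F \<Longrightarrow> q_coeff f n = fls_nth F n"
  unfolding q_coeff_def using has_q_expansion_unique by (subst the_equality[of _ F]) auto

text \<open>\<open>A\<close> maps the cusp at infinity to the (finite) cusp \<open>r\<close>.\<close>
definition maps_infinity_to :: "int ^ 2 ^ 2 \<Rightarrow> rat \<Rightarrow> bool" where
  "maps_infinity_to A r \<longleftrightarrow> A $ 2 $ 1 \<noteq> 0 \<and> of_int (A $ 1 $ 1) / of_int (A $ 2 $ 1) = r"

text \<open>
  Behaviour at cusps is read off from the expansions of \<open>slash k f A\<close>, where \<open>A\<close> maps infinity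
  to the cusp. The parameter \<open>N\<close> is the level: every cusp of \<open>Gamma0 N\<close> has width dividing \<open>N\<close>, so
  expansions in \<open>exp (2 * pi * i * z / N)\<close> serve for all cusps.
\<close>
definition weakly_holomorphic_form :: "int \<Rightarrow> nat \<Rightarrow> (complex \<Rightarrow> complex) \<Rightarrow> bool" where
  "weakly_holomorphic_form k N f \<longleftrightarrow>
     f holomorphic_on upper_half_plane \<and>
     (\<forall>A\<in>Gamma0 (int N). \<forall>z\<in>upper_half_plane. slash k f A z = f z) \<and>
     (\<forall>A\<in>SL2Z. \<exists>F. has_q_expansion N (slash k f A) F)"

definition holomorphic_at_cusp :: "int \<Rightarrow> nat \<Rightarrow> (complex \<Rightarrow> complex) \<Rightarrow> rat \<Rightarrow> bool" where
  "holomorphic_at_cusp k N f r \<longleftrightarrow>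
     (\<forall>A\<in>SL2Z. maps_infinity_to A r \<longrightarrow>
        (\<exists>F. has_q_expansion N (slash k f A) F \<and> (\<forall>j<0. fls_nth F j = 0)))"

definition vanishes_at_cusp :: "int \<Rightarrow> nat \<Rightarrow> (complex \<Rightarrow> complex) \<Rightarrow> rat \<Rightarrow> bool" where
  "vanishes_at_cusp k N f r \<longleftrightarrow>
     (\<forall>A\<in>SL2Z. maps_infinity_to A r \<longrightarrow>
        (\<exists>F. has_q_expansion N (slash k f A) F \<and> (\<forall>j\<le>0. fls_nth F j = 0)))"

definition M_sharp4 :: "int \<Rightarrow> (complex \<Rightarrow> complex) set" where
  "M_sharp4 k = {f. weakly_holomorphic_form k 4 f \<and>
     holomorphic_at_cusp k 4 f 0 \<and> holomorphic_at_cusp k 4 f (1 / 2)}"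

text \<open>
  For even \<open>k = 2 * l\<close>, the defining properties of the basis elements \<open>f\<^bsub>k,m\<^esub> = q\<^bsup>-m\<^esup> + O(q\<^bsup>l+1\<^esup>)\<close>
  (for \<open>m \<ge> -l\<close>) and \<open>g\<^bsub>k,m\<^esub> = q\<^bsup>-m\<^esup> + O(q\<^bsup>l-1\<^esup>)\<close> (for \<open>m \<ge> -l+2\<close>). They are predicates rather
  than definite descriptions since they determine a function only on the upper half plane.
\<close>
definition is_f4 :: "int \<Rightarrow> int \<Rightarrow> (complex \<Rightarrow> complex) \<Rightarrow> bool" where
  "is_f4 k m f \<longleftrightarrow> f \<in> M_sharp4 k \<and>
     (\<exists>R. has_q_expansion 1 f (fls_X_intpow (- m) + R) \<and> (\<forall>j < k div 2 + 1. fls_nth R j = 0))"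

definition is_g4 :: "int \<Rightarrow> int \<Rightarrow> (complex \<Rightarrow> complex) \<Rightarrow> bool" where
  "is_g4 k m g \<longleftrightarrow> g \<in> M_sharp4 k \<and> vanishes_at_cusp k 4 g 0 \<and> vanishes_at_cusp k 4 g (1 / 2) \<and>
     (\<exists>R. has_q_expansion 1 g (fls_X_intpow (- m) + R) \<and> (\<forall>j < k div 2 - 1. fls_nth R j = 0))"

end

(* The product h = f g is a form of weight 2 whose constant term at infinity is
   a(m,n) + b(n,m), and h has no constant term at the cusps 0 and 1/2. Integrating the
   expansion of h termwise gives a primitive P on the upper half plane with
   P(z + 1) = P(z) + c, where c is the constant term at infinity. For A in SL2(Z), the map
   z \<mapsto> P(A z) is a primitive of h|A, so P is invariant under A T^4 A^(-1), T z = z + 1, for A sending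
   infinity to 0 or 1/2. The relation between the parabolic generators of Gamma_0(4) then
   forces 4 c = 0. This replaces the residue theorem on the modular curve. *)
theory Submission
  imports Defs
begin

section \<open>Termwise integration of q-expansions\<close>

lemma conv_radius_antimono:
  fixes f g :: "nat \<Rightarrow> 'a :: banach"
  assumes "\<And>n. norm (f n) \<le> norm (g n)"
  shows   "conv_radius g \<le> conv_radius f"
  unfolding conv_radius_altdef
proof (intro Liminf_mono eventually_mono[OF eventually_gt_at_top[of 0]])
  fix n :: nat assume "n > 0"
  then show "inverse (ereal (root n (norm (g n)))) \<le> inverse (ereal (root n (norm (f n))))"
    using assms[of n] by (intro ereal_inverse_antimono) (auto simp: real_root_ge_zero)
qed

text \<open>For n > 0, shifting and then integrating divides the coefficient of x^n by n; the
  constant coefficient becomes 0. No coefficient of the regular part grows in norm, so the radius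
  cannot shrink.\<close>

lemma fls_conv_radius_integral_shift:
  fixes F :: "complex fls"
  shows "fls_conv_radius F \<le> fls_conv_radius (fls_integral (fls_shift 1 F))"
  unfolding fls_conv_radius_def fps_conv_radius_def
proof (rule conv_radius_antimono)
  fix n :: nat
  show "norm (fps_nth (fls_regpart (fls_integral (fls_shift 1 F))) n)
          \<le> norm (fps_nth (fls_regpart F) n)"
  proof (cases n)
    case (Suc i)
    then have "norm (fls_nth F (int n)) / real n \<le> norm (fls_nth F (int n)) / 1"
      by (intro divide_left_mono) auto
    with Suc show ?thesis
      by (simp add: norm_divide divide_inverse_commute norm_mult norm_inverse del: of_nat_Suc)
  qed auto
qed

text \<open>The shift is division by x, which turns the constant term of \<open>F\<close> into a
  multiple of 1/x. That term has no primitive among Laurent series and \<open>fls_integral\<close>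
  drops it, hence the subtraction.\<close>

lemma eval_fls_deriv_integral_shift:
  fixes F :: "complex fls"
  assumes "ereal (norm x) < fls_conv_radius F" "x \<noteq> 0"
  shows "eval_fls (fls_deriv (fls_integral (fls_shift 1 F))) x = (eval_fls F x - fls_nth F 0) / x"
proof -
  have "fls_deriv (fls_integral (fls_shift 1 F)) = fls_shift 1 (F - fls_const (fls_nth F 0))"
  proof (rule fls_eqI)
    fix j :: int
    show "fls_nth (fls_deriv (fls_integral (fls_shift 1 F))) j
            = fls_nth (fls_shift 1 (F - fls_const (fls_nth F 0))) j"
    proof (cases "j + 1 = 0")
      case False
      then have "(of_int (j + 1) :: complex) \<noteq> 0"
        by (simp only: of_int_eq_0_iff not_False_eq_True)
      with False show ?thesis
        by (simp del: of_int_add flip: mult.assoc)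
    qed simp
  qed
  then show ?thesis
    using assms by (simp only:) (simp add: eval_fls_shift eval_fls_diff power_int_minus field_simps)
qed

lemma norm_q_less_1:
  assumes "z \<in> upper_half_plane" "w > 0"
  shows   "norm (exp (2 * of_real pi * \<i> * z / of_nat w)) < 1"
  using assms by (auto simp: upper_half_plane_def norm_exp_eq_Re Re_divide_of_nat mult_pos_pos)

lemma norm_q_less_conv_radius:
  assumes "has_q_expansion w f F" "z \<in> upper_half_plane" "w > 0"
  shows   "ereal (norm (exp (2 * of_real pi * \<i> * z / of_nat w))) < fls_conv_radius F"
proof (rule less_le_trans)
  show "ereal (norm (exp (2 * of_real pi * \<i> * z / of_nat w))) < 1"
    using norm_q_less_1[OF assms(2,3)] by simp
  show "1 \<le> fls_conv_radius F"
    using assms(1) by (simp add: has_q_expansion_def)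
qed

text \<open>Terms with nonzero exponent integrate to a series in the same exponential, which has
  period \<open>w\<close>. The constant term integrates to a linear function of z, the only source
  of the increment.\<close>

lemma q_expansion_primitive:
  assumes F: "has_q_expansion w f F" and w: "w > 0"
  obtains P where
    "\<And>z. z \<in> upper_half_plane \<Longrightarrow> (P has_field_derivative f z) (at z)"
    "\<And>z. P (z + of_nat w) = P z + of_nat w * fls_nth F 0"
proof
  define G where "G = fls_integral (fls_shift 1 F)"
  define e where "e = (\<lambda>z. exp (2 * of_real pi * \<i> * z / of_nat w :: complex))"
  \<comment> \<open>With q = \<open>e z\<close>, the chain rule gives dz = w / (2 pi i) dq / q,
    which explains both the factor and the division by x in \<open>G\<close>.\<close>
  define P where
    "P = (\<lambda>z. of_nat w / (2 * of_real pi * \<i>) * eval_fls G (e z) + fls_nth F 0 * z)"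
  show "(P has_field_derivative f z) (at z)" if z: "z \<in> upper_half_plane" for z
  proof -
    have rF: "ereal (norm (e z)) < fls_conv_radius F"
      unfolding e_def by (rule norm_q_less_conv_radius[OF F z w])
    hence rG: "ereal (norm (e z)) < fls_conv_radius G"
      using fls_conv_radius_integral_shift unfolding G_def by (rule less_le_trans)
    have "e z \<noteq> 0"
      by (simp add: e_def)
    have dG: "(eval_fls G has_field_derivative (f z - fls_nth F 0) / e z) (at (e z))"
    proof (rule DERIV_cong)
      show "(eval_fls G has_field_derivative eval_fls (fls_deriv G) (e z)) (at (e z))"
        using rG \<open>e z \<noteq> 0\<close> by (intro has_field_derivative_eval_fls) (auto simp: in_eball_iff)
      show "eval_fls (fls_deriv G) (e z) = (f z - fls_nth F 0) / e z"
        using F z rF \<open>e z \<noteq> 0\<close>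
        by (simp add: G_def eval_fls_deriv_integral_shift has_q_expansion_def e_def)
    qed
    have de: "(e has_field_derivative 2 * of_real pi * \<i> / of_nat w * e z) (at z)"
      unfolding e_def using w by (auto intro!: derivative_eq_intros)
    show ?thesis
      unfolding P_def using w \<open>e z \<noteq> 0\<close>
      by (auto intro!: derivative_eq_intros DERIV_chain2[OF dG de])
  qed
  show "P (z + of_nat w) = P z + of_nat w * fls_nth F 0" for z
  proof -
    have "2 * of_real pi * \<i> * (z + of_nat w) / of_nat w
            = 2 * of_real pi * \<i> * z / of_nat w + 2 * of_real pi * \<i>"
      using w by (simp add: field_simps)
    hence "e (z + of_nat w) = e z"
      by (simp add: e_def exp_add)
    then show ?thesis
      by (simp add: P_def algebra_simps)
  qed
qed

lemma add_of_nat_in_upper_half_plane: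
  "z \<in> upper_half_plane \<Longrightarrow> z + of_nat w \<in> upper_half_plane"
  by (simp add: upper_half_plane_def)

text \<open>Two primitives differ by a constant on the convex half plane, so the increment does not
  depend on the primitive. This makes it available for primitives obtained by substitution instead
  of termwise integration.\<close>

lemma primitive_translate:
  assumes F: "has_q_expansion w f F" and w: "w > 0"
    and Q: "\<And>z. z \<in> upper_half_plane \<Longrightarrow> (Q has_field_derivative f z) (at z)"
    and z: "z \<in> upper_half_plane"
  shows "Q (z + of_nat w) = Q z + of_nat w * fls_nth F 0"
proof -
  obtain P where
    P: "\<And>z. z \<in> upper_half_plane \<Longrightarrow> (P has_field_derivative f z) (at z)" and
    P_trans: "\<And>z. P (z + of_nat w) = P z + of_nat w * fls_nth F 0"
    using q_expansion_primitive[OF F w] by blast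
  have "convex upper_half_plane"
    unfolding upper_half_plane_def by (rule convex_halfspace_Im_gt)
  moreover have "((\<lambda>z. Q z - P z) has_field_derivative 0) (at z within upper_half_plane)"
    if "z \<in> upper_half_plane" for z
    using DERIV_diff[OF Q[OF that] P[OF that]] by (auto intro: has_field_derivative_at_within)
  ultimately obtain c where "\<forall>z\<in>upper_half_plane. Q z - P z = c"
    using has_field_derivative_zero_constant[of upper_half_plane "\<lambda>z. Q z - P z"] by blast
  then have "Q (z + of_nat w) - P (z + of_nat w) = Q z - P z"
    using z add_of_nat_in_upper_half_plane by metis
  then show ?thesis
    by (simp add: P_trans algebra_simps)
qed

section \<open>Moebius transformations and the slash operator\<close>

lemma moebius_denominator_nonzero:
  fixes A :: "int ^ 2 ^ 2"
  assumes "A \<in> SL2Z" "z \<in> upper_half_plane"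
  shows   "of_int (A $ 2 $ 1) * z + of_int (A $ 2 $ 2) \<noteq> (0 :: complex)"
proof
  assume eq: "of_int (A $ 2 $ 1) * z + of_int (A $ 2 $ 2) = (0 :: complex)"
  have "A $ 2 $ 1 = 0"
    using arg_cong[OF eq, of Im] assms by (simp add: upper_half_plane_def)
  moreover from this have "A $ 2 $ 2 = 0"
    using eq by simp
  ultimately show False
    using assms(1) by (simp add: SL2Z_def det_2)
qed

lemma moebius_mat_in_upper_half_plane:
  fixes A :: "int ^ 2 ^ 2"
  assumes A: "A \<in> SL2Z" and z: "z \<in> upper_half_plane"
  shows   "moebius_mat A z \<in> upper_half_plane"
proof -
  define a b c d where "a = real_of_int (A $ 1 $ 1)" "b = real_of_int (A $ 1 $ 2)"
    "c = real_of_int (A $ 2 $ 1)" "d = real_of_int (A $ 2 $ 2)"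
  have det: "a * d - b * c = 1"
    using A by (simp add: SL2Z_def det_2 a_b_c_d_def flip: of_int_mult of_int_diff)
  have eq: "moebius_mat A z = (of_real a * z + of_real b) / (of_real c * z + of_real d)"
    by (simp add: moebius_mat_def a_b_c_d_def)
  have nz: "of_real c * z + of_real d \<noteq> 0"
    using moebius_denominator_nonzero[OF A z] by (simp add: a_b_c_d_def)
  have "Im (moebius_mat A z) =
          (a * Im z * (c * Re z + d) - (a * Re z + b) * (c * Im z))
            / (norm (of_real c * z + of_real d))\<^sup>2"
    by (simp add: eq Im_divide cmod_power2)
  also have "a * Im z * (c * Re z + d) - (a * Re z + b) * (c * Im z) = (a * d - b * c) * Im z"
    by (simp add: algebra_simps)
  finally show ?thesis
    using nz z by (simp add: det upper_half_plane_def)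
qed

lemma moebius_mat_has_field_derivative:
  fixes A :: "int ^ 2 ^ 2"
  assumes A: "A \<in> SL2Z" and z: "z \<in> upper_half_plane"
  shows   "(moebius_mat A has_field_derivative
             (of_int (A $ 2 $ 1) * z + of_int (A $ 2 $ 2)) powi (- 2)) (at z)"
proof -
  define a b c d where "a = (of_int (A $ 1 $ 1) :: complex)" "b = (of_int (A $ 1 $ 2) :: complex)"
    "c = (of_int (A $ 2 $ 1) :: complex)" "d = (of_int (A $ 2 $ 2) :: complex)"
  have det: "a * d - b * c = 1"
    using A by (simp add: SL2Z_def det_2 a_b_c_d_def flip: of_int_mult of_int_diff)
  have nz: "c * z + d \<noteq> 0"
    using moebius_denominator_nonzero[OF A z] by (simp add: a_b_c_d_def)
  have "((\<lambda>z. (a * z + b) / (c * z + d)) has_field_derivative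
          (a * (c * z + d) - (a * z + b) * c) / ((c * z + d) * (c * z + d))) (at z)"
    using nz by (auto intro!: derivative_eq_intros)
  also have "a * (c * z + d) - (a * z + b) * c = a * d - b * c"
    by (simp add: algebra_simps)
  also have "\<dots> / ((c * z + d) * (c * z + d)) = (c * z + d) powi (- 2)"
    by (simp add: det power_int_minus power2_eq_square divide_simps)
  finally show ?thesis
    by (simp add: moebius_mat_def[abs_def] a_b_c_d_def)
qed

text \<open>The derivative of a Moebius map of determinant 1 is (c z + d)^(-2), exactly the
  automorphy factor of weight 2, so this is the chain rule.\<close>

lemma slash_2_primitive:
  fixes A :: "int ^ 2 ^ 2"
  assumes A: "A \<in> SL2Z"
    and P: "\<And>z. z \<in> upper_half_plane \<Longrightarrow> (P has_field_derivative h z) (at z)"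
    and z: "z \<in> upper_half_plane"
  shows "((\<lambda>z. P (moebius_mat A z)) has_field_derivative slash 2 h A z) (at z)"
  using DERIV_chain2[OF P[OF moebius_mat_in_upper_half_plane[OF A z]]
      moebius_mat_has_field_derivative[OF A z]]
  by (simp add: slash_def mult.commute)

lemma slash_mult:
  fixes A :: "int ^ 2 ^ 2"
  assumes "A \<in> SL2Z" "z \<in> upper_half_plane"
  shows   "slash (j + k) (\<lambda>z. f z * g z) A z = slash j f A z * slash k g A z"
proof -
  define x where "x = of_int (A $ 2 $ 1) * z + (of_int (A $ 2 $ 2) :: complex)"
  have "x \<noteq> 0"
    unfolding x_def by (rule moebius_denominator_nonzero[OF assms])
  then have "x powi (- (j + k)) = x powi (- j) * x powi (- k)"
    by (simp flip: power_int_add)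
  then show ?thesis
    by (simp add: slash_def x_def)
qed

lemma has_q_expansion_mult:
  assumes F: "has_q_expansion w f F" and G: "has_q_expansion w g G" and w: "w > 0"
  shows   "has_q_expansion w (\<lambda>z. f z * g z) (F * G)"
  unfolding has_q_expansion_def
proof (intro conjI ballI)
  show "fls_conv_radius (F * G) \<ge> 1"
    using F G by (intro fls_conv_radius_mult_ge) (auto simp: has_q_expansion_def)
  fix z assume z: "z \<in> upper_half_plane"
  define q where "q = exp (2 * of_real pi * \<i> * z / of_nat w)"
  have "eval_fls (F * G) q = eval_fls F q * eval_fls G q"
    unfolding q_def
    by (intro eval_fls_mult norm_q_less_conv_radius[OF F z w] norm_q_less_conv_radius[OF G z w]) simp
  then show "f z * g z = eval_fls (F * G) (exp (2 * of_real pi * \<i> * z / of_nat w))"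
    using F G z by (simp add: has_q_expansion_def q_def)
qed

lemma has_q_expansion_cong:
  assumes "\<And>z. z \<in> upper_half_plane \<Longrightarrow> f z = g z"
  shows   "has_q_expansion w f F \<longleftrightarrow> has_q_expansion w g F"
  using assms by (simp add: has_q_expansion_def)

section \<open>The constant term of a form of weight 2\<close>

lemma constant_term_eq_0:
  fixes h :: "complex \<Rightarrow> complex"
  assumes H: "has_q_expansion 1 h H"
    and cusp_0: "\<And>A. A \<in> SL2Z \<Longrightarrow> maps_infinity_to A 0 \<Longrightarrow>
                   \<exists>F. has_q_expansion 4 (slash 2 h A) F \<and> fls_nth F 0 = 0"
    and cusp_half: "\<And>A. A \<in> SL2Z \<Longrightarrow> maps_infinity_to A (1 / 2) \<Longrightarrow>
                   \<exists>F. has_q_expansion 4 (slash 2 h A) F \<and> fls_nth F 0 = 0"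
  shows "fls_nth H 0 = 0"
proof -
  obtain P where
    P: "\<And>z. z \<in> upper_half_plane \<Longrightarrow> (P has_field_derivative h z) (at z)" and
    P_trans: "\<And>z. P (z + of_nat 1) = P z + of_nat 1 * fls_nth H 0"
    using q_expansion_primitive[OF H] by auto
  \<comment> \<open>Substituting \<open>moebius_mat A\<close> into \<open>P\<close> gives a
    primitive of \<open>slash 2 h A\<close>; its increment over the width 4 is four times a
    vanishing constant term.\<close>
  have invariant: "P (moebius_mat A (z + 4)) = P (moebius_mat A z)"
    if "A \<in> SL2Z" "z \<in> upper_half_plane"
      and "\<exists>F. has_q_expansion 4 (slash 2 h A) F \<and> fls_nth F 0 = 0" for A z
  proof -
    from that obtain F where "has_q_expansion 4 (slash 2 h A) F" "fls_nth F 0 = 0"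
      by blast
    then show ?thesis
      using primitive_translate[of 4 _ F "\<lambda>z. P (moebius_mat A z)" z] that slash_2_primitive P
      by simp
  qed

  define S :: "int ^ 2 ^ 2" where "S = vector [vector [0, -1], vector [1, 0]]"
  have S: "S \<in> SL2Z" "maps_infinity_to S 0" "\<And>z. moebius_mat S z = - 1 / z"
    by (simp_all add: S_def SL2Z_def det_2 maps_infinity_to_def moebius_mat_def)
  \<comment> \<open>The map U u = u / (4 u + 1) is translation by -4 conjugated by \<open>S\<close>,
    so invariance at the cusp 0 applies at the point -1/u - 4.\<close>
  have P_U: "P (u / (4 * u + 1)) = P u" if u: "u \<in> upper_half_plane" for u
  proof -
    have "u \<noteq> 0" "4 * u + 1 \<noteq> 0"
      using u by (auto simp: upper_half_plane_def complex_eq_iff)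
    have "- 1 / u \<in> upper_half_plane"
      using moebius_mat_in_upper_half_plane[OF S(1) u] S(3) by simp
    then have "- 1 / u - 4 \<in> upper_half_plane"
      by (simp add: upper_half_plane_def)
    from invariant[OF S(1) this] cusp_0 S have "P u = P (- 1 / (- 1 / u - 4))"
      by simp
    also have "- 1 / (- 1 / u - 4) = u / (4 * u + 1)"
    proof -
      have "- 1 / u - 4 = - ((4 * u + 1) / u)"
        using \<open>u \<noteq> 0\<close> by (simp add: field_simps)
      then show ?thesis
        by simp
    qed
    finally show ?thesis ..
  qed

  define A :: "int ^ 2 ^ 2" where "A = vector [vector [1, 0], vector [2, 1]]"
  have A: "A \<in> SL2Z" "maps_infinity_to A (1 / 2)" "\<And>z. moebius_mat A z = z / (2 * z + 1)"
    by (simp_all add: A_def SL2Z_def det_2 maps_infinity_to_def moebius_mat_def)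
  \<comment> \<open>\<open>A T A\<^sup>-\<^sup>1 = - U T\<^sup>-\<^sup>1\<close> with \<open>T z = z + 1\<close> and \<open>U z = z / (4 z + 1)\<close>\<close>
  have step: "P (moebius_mat A (z + 1)) = P (moebius_mat A z) - fls_nth H 0"
    if z: "z \<in> upper_half_plane" for z
  proof -
    \<comment> \<open>This is T^(-1) applied to A z. Hence A (z + 1) = U u, and passing from u + 1 =
      A z back to u costs one constant term.\<close>
    define u where "u = moebius_mat A z - 1"
    have nz: "2 * z + 1 \<noteq> 0" "2 * z + 3 \<noteq> 0"
      using z by (auto simp: upper_half_plane_def complex_eq_iff)
    have u: "u \<in> upper_half_plane"
      using moebius_mat_in_upper_half_plane[OF A(1) z] by (simp add: u_def upper_half_plane_def)
    have u_eq: "u = - ((z + 1) / (2 * z + 1))" "4 * u + 1 = - ((2 * z + 3) / (2 * z + 1))"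
      using nz by (simp_all add: u_def A(3) field_simps)
    have "moebius_mat A (z + 1) = (z + 1) / (2 * z + 3)"
      by (simp add: A(3) algebra_simps)
    also have "\<dots> = u / (4 * u + 1)"
      unfolding u_eq(2) unfolding u_eq(1) minus_divide_divide using nz by simp
    finally have "P (moebius_mat A (z + 1)) = P u"
      using P_U[OF u] by simp
    also have "\<dots> = P (moebius_mat A z) - fls_nth H 0"
      using P_trans[of u] by (simp add: u_def)
    finally show ?thesis .
  qed
  \<comment> \<open>The hypothesis at 1/2 concerns expansions in exp (2 pi i z / 4) and so yields
    only the period 4. Comparing it with four unit steps forces four times the constant term of
    \<open>H\<close> to be 0.\<close>
  have iterate: "P (moebius_mat A (z + of_nat j)) = P (moebius_mat A z) - of_nat j * fls_nth H 0"
    if z: "z \<in> upper_half_plane" for z j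
  proof (induction j)
    case (Suc j)
    have "P (moebius_mat A (z + of_nat (Suc j))) = P (moebius_mat A (z + of_nat j)) - fls_nth H 0"
      using step[OF add_of_nat_in_upper_half_plane[OF z, of j]] by (simp add: add_ac)
    then show ?case
      by (simp only: Suc.IH) (simp add: algebra_simps)
  qed simp
  have "\<i> \<in> upper_half_plane"
    by (simp add: upper_half_plane_def)
  from invariant[OF A(1) this] iterate[OF this, of 4] cusp_half A show ?thesis
    by simp
qed

section \<open>Duality of the coefficients\<close>

lemma fls_times_nth_eq_0:
  fixes F G :: "'a :: semiring_0 fls"
  assumes "\<And>i. i < a \<Longrightarrow> fls_nth F i = 0" "\<And>i. i < b \<Longrightarrow> fls_nth G i = 0" "j < a + b"
  shows   "fls_nth (F * G) j = 0"
\<comment> \<open>The zero series has \<open>fls_subdegree\<close> 0 by convention, so the bounds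
  \<open>a\<close> and \<open>b\<close> pass to the subdegrees only for nonzero series.\<close>
proof (cases "F = 0 \<or> G = 0")
  case False
  then have "a \<le> fls_subdegree F" "b \<le> fls_subdegree G"
    using assms(1,2) by (auto intro: fls_subdegree_geI)
  then show ?thesis
    using assms(3) by (intro fls_times_nth_eq0) auto
qed auto

text \<open>Orders at a cusp add: order at least 0 for \<open>f\<close> and at least 1 for
  \<open>g\<close> give order at least 1 for the product.\<close>

lemma slash_mult_constant_term_eq_0:
  assumes f: "holomorphic_at_cusp j N f r" and g: "vanishes_at_cusp k N g r" and N: "N > 0"
    and A: "A \<in> SL2Z" "maps_infinity_to A r"
  shows "\<exists>F. has_q_expansion N (slash (j + k) (\<lambda>z. f z * g z) A) F \<and> fls_nth F 0 = 0"
proof -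
  obtain F where F: "has_q_expansion N (slash j f A) F" "\<And>i. i < 0 \<Longrightarrow> fls_nth F i = 0"
    using f A by (auto simp: holomorphic_at_cusp_def)
  obtain G where G: "has_q_expansion N (slash k g A) G" "\<And>i. i \<le> 0 \<Longrightarrow> fls_nth G i = 0"
    using g A by (auto simp: vanishes_at_cusp_def)
  have "has_q_expansion N (slash (j + k) (\<lambda>z. f z * g z) A) (F * G)"
    using has_q_expansion_mult[OF F(1) G(1) N] slash_mult[OF A(1)]
    by (subst has_q_expansion_cong[where g = "\<lambda>z. slash j f A z * slash k g A z"]) auto
  moreover have "fls_nth (F * G) 0 = 0"
    using F(2) G(2) by (intro fls_times_nth_eq_0[of 0 F 1 G]) auto
  ultimately show ?thesis
    by blast
qed

theorem theorem2:
  fixes k l m n :: int and f g :: "complex \<Rightarrow> complex"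
  assumes "k = 2 * l"
    and "m \<ge> - l" and "n \<ge> l + 1"
    and "is_f4 k m f"
    and "is_g4 (2 - k) n g"
  shows "q_coeff f n = - q_coeff g m"
proof -
  \<comment> \<open>The weight of \<open>g\<close> is 2 (1 - l), so its remainder starts at (1 - l)
    - 1 = - l. The two starting exponents add up to 1.\<close>
  have div: "k div 2 + 1 = l + 1" "(2 - k) div 2 - 1 = - l"
    using assms(1) by auto
  obtain R where R: "has_q_expansion 1 f (fls_X_intpow (- m) + R)"
      "\<And>j. j < l + 1 \<Longrightarrow> fls_nth R j = 0"
    using assms(4) unfolding is_f4_def div by blast
  obtain S where S: "has_q_expansion 1 g (fls_X_intpow (- n) + S)"
      "\<And>j. j < - l \<Longrightarrow> fls_nth S j = 0"
    using assms(5) unfolding is_g4_def div by blast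
  define H where "H = (fls_X_intpow (- m) + R) * (fls_X_intpow (- n) + S)"
  have "has_q_expansion 1 (\<lambda>z. f z * g z) H"
    unfolding H_def by (intro has_q_expansion_mult R S) simp
  moreover have "holomorphic_at_cusp k 4 f 0" "holomorphic_at_cusp k 4 f (1 / 2)"
    using assms(4) by (auto simp: is_f4_def M_sharp4_def)
  moreover have "vanishes_at_cusp (2 - k) 4 g 0" "vanishes_at_cusp (2 - k) 4 g (1 / 2)"
    using assms(5) by (auto simp: is_g4_def)
  \<comment> \<open>The weights k and 2 - k add up to 2, so the product satisfies the hypotheses of
    the weight 2 result.\<close>
  ultimately have "fls_nth H 0 = 0"
    using slash_mult_constant_term_eq_0[of k 4 f _ "2 - k" g]
    by (intro constant_term_eq_0[of "\<lambda>z. f z * g z"]) auto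
  moreover have "fls_nth (R * S) 0 = 0"
    using R(2) S(2) by (intro fls_times_nth_eq_0[of "l + 1" R "- l" S]) auto
  \<comment> \<open>Since m + n \<ge> 1, the first summand has negative exponent;
    \<open>R * S\<close> starts at q^1. The constant term thus comes from the two shifts alone, as
    coefficient \<open>m\<close> of \<open>S\<close> plus coefficient \<open>n\<close> of
    \<open>R\<close>.\<close>
  moreover have "H = fls_X_intpow (- m - n) + fls_shift m S + fls_shift n R + R * S"
    by (simp add: H_def distrib_left distrib_right fls_X_intpow_times_conv_shift
        fls_shifted_times_simps add_ac)
  ultimately have "fls_nth R n + fls_nth S m = 0"
    using assms(2,3) by (simp add: add_ac)
  \<comment> \<open>The leading monomials do not interfere: n = - m is excluded by m + n \<ge>
    1.\<close>
  moreover have "q_coeff f n = fls_nth R n" "q_coeff g m = fls_nth S m"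
    using assms(2,3) by (simp_all add: q_coeff_eq[OF R(1)] q_coeff_eq[OF S(1)])
  ultimately show ?thesis
    by (simp add: eq_neg_iff_add_eq_0)
qed

end
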